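(* Let $K\subseteq\mathbb{R}^n$ be a rationally generated closed convex cone (not necessarily full-dimensional). Then $K$ has the Interior Ryshkov property (is IR), i.e. $\mathcal{R}_K\subseteq \mathrm{int}\,\mathcal{COP}_K$.
   Context: $\mathcal{S}^n$ is the space of real symmetric $n\times n$ matrices with inner product $\langle A,B\rangle=\mathrm{Trace}(AB)$; for $Q\in\mathcal{S}^n$ and $x\in\mathbb{R}^n$ write $Q[x]=x^{T}Qx$. A convex cone $K$ is closed under $\lambda x+\mu y$ for $x,y\in K$, $\lambda,\mu\ge 0$. $K$ is rationally generated if it is generated by rational (equivalently, integral) vectors, i.e. every element of $K$ is a finite nonnegative linear combination of vectors in $K\cap\mathbb{Z}^n$. The cone of generalized copositive matrices over $K$ is $\mathcal{COP}_K=\{Q\in\mathcal{S}^n : Q[x]\ge 0\text{ for all }x\in K\}$; $\mathrm{int}$ and $\mathrm{bd}$ denote topological interior and boundary in $\mathcal{S}^n$. The generalized Ryshkov set is $\mathcal{R}_K=\{Q\in\mathcal{S}^n : Q[z]\ge 1\text{ for all } z\in K\cap\mathbb{Z}^n\setminus\{0\}\}$. The $K$-copositive minimum of $Q$ is $\min_{\mathcal{COP}_K}Q=\inf\{Q[z] : z\in K\cap\mathbb{Z}^n\setminus\{0\}\}$. A closed convex cone $K$ has the Interior Ryshkov (IR) property if $Q\in\mathrm{bd}\,\mathcal{COP}_K$ implies $\min_{\mathcal{COP}_K}Q=0$. *)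

theory Defs
  imports "HOL-Analysis.Analysis"
begin

definition sym_mats :: "(real ^ 'n ^ 'n) set" where
  "sym_mats = {Q. transpose Q = Q}"

text \<open>The topology of the space of symmetric matrices. On symmetric matrices the inner product
  of \<^typ>\<open>real ^ 'n ^ 'n\<close> is the trace inner product.\<close>

abbreviation sym_topology :: "(real ^ 'n ^ 'n) topology" where
  "sym_topology \<equiv> top_of_set sym_mats"

definition qform :: "real ^ 'n ^ 'n \<Rightarrow> real ^ 'n \<Rightarrow> real" where
  "qform Q x = x \<bullet> (Q *v x)"

definition int_vecs :: "(real ^ 'n) set" where
  "int_vecs = {z. \<forall>i. z $ i \<in> \<int>}"

text \<open>The library predicates \<^const>\<open>convex\<close> and \<^const>\<open>cone\<close> together say that a set is closed under
  nonnegative combinations of two elements.\<close>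

lemma convex_cone_closed_under_combinations:
  fixes K :: "'a :: real_vector set"
  shows "convex K \<and> cone K \<longleftrightarrow>
    (\<forall>x\<in>K. \<forall>y\<in>K. \<forall>l m. 0 \<le> l \<longrightarrow> 0 \<le> m \<longrightarrow> l *\<^sub>R x + m *\<^sub>R y \<in> K)"
proof
  assume "convex K \<and> cone K"
  then show "\<forall>x\<in>K. \<forall>y\<in>K. \<forall>l m. 0 \<le> l \<longrightarrow> 0 \<le> m \<longrightarrow> l *\<^sub>R x + m *\<^sub>R y \<in> K"
    by (simp add: convex_cone)
next
  assume *: "\<forall>x\<in>K. \<forall>y\<in>K. \<forall>l m. 0 \<le> l \<longrightarrow> 0 \<le> m \<longrightarrow> l *\<^sub>R x + m *\<^sub>R y \<in> K"
  have "c *\<^sub>R x \<in> K" if "x \<in> K" "0 \<le> c" for c x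
    using *[rule_format, of x x c 0] that by simp
  moreover have "convex K"
    using * by (simp add: convex_def)
  ultimately show "convex K \<and> cone K"
    by (simp add: cone_def)
qed

definition rationally_generated :: "(real ^ 'n) set \<Rightarrow> bool" where
  "rationally_generated K \<longleftrightarrow>
    (\<forall>x\<in>K. \<exists>S c. finite S \<and> S \<subseteq> K \<inter> int_vecs \<and> (\<forall>v\<in>S. 0 \<le> c v) \<and>
      x = (\<Sum>v\<in>S. c v *\<^sub>R v))"

definition COP :: "(real ^ 'n) set \<Rightarrow> (real ^ 'n ^ 'n) set" where
  "COP K = {Q \<in> sym_mats. \<forall>x\<in>K. 0 \<le> qform Q x}"

definition ryshkov :: "(real ^ 'n) set \<Rightarrow> (real ^ 'n ^ 'n) set" where
  "ryshkov K = {Q \<in> sym_mats. \<forall>z \<in> K \<inter> int_vecs - {0}. 1 \<le> qform Q z}"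

text \<open>The infimum is taken in the extended reals: the infimum over the empty set (as for \<open>K = {0}\<close>)
  is \<open>\<infinity>\<close>, whereas the real-valued \<^const>\<open>Inf\<close> is unspecified there.\<close>

definition cop_min :: "(real ^ 'n) set \<Rightarrow> real ^ 'n ^ 'n \<Rightarrow> ereal" where
  "cop_min K Q = (INF z \<in> K \<inter> int_vecs - {0}. ereal (qform Q z))"

definition interior_ryshkov :: "(real ^ 'n) set \<Rightarrow> bool" where
  "interior_ryshkov K \<longleftrightarrow> (\<forall>Q \<in> sym_topology frontier_of (COP K). cop_min K Q = 0)"

end

theory Submission
  imports Defs
begin

text \<open>
  The point is that an isotropic ray of a form that is nonnegative on \<open>K\<close> can be followed by lattice
  points of \<open>K\<close> at no cost, even if the ray is irrational.

  Let \<open>Q\<close> lie on the boundary of the generalized copositive cone. By compactness of the unit sphere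
  of \<open>K\<close>, there is \<open>0 \<noteq> x \<in> K\<close> with \<open>Q[x] = 0\<close> (\<open>COP_frontier_isotropic\<close>). Write \<open>x\<close> as a
  combination of integral vectors \<open>v \<in> K\<close> with coefficients \<open>c v > 0\<close>. First-order optimality of \<open>x\<close>
  gives \<open>\<langle>v, Q x\<rangle> \<ge> 0\<close> for each \<open>v\<close>; since these numbers, weighted by the positive \<open>c v\<close>, sum to
  \<open>Q[x] = 0\<close>, they all vanish (\<open>COP_isotropic_orthogonal\<close>). So \<open>Q x\<close> is orthogonal to the span of the
  generators that occur in \<open>x\<close>. Simultaneous Diophantine approximation of the coefficients \<open>c v\<close>
  produces an integer \<open>t \<ge> 1\<close> and an integral vector \<open>z \<in> K\<close> such that \<open>e = z - t x\<close> is arbitrarily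
  small and belongs to that span (\<open>integral_approximation_of_multiple\<close>). Both \<open>t\<^sup>2 Q[x]\<close> and the mixed term
  \<open>2 t \<langle>e, Q x\<rangle>\<close> vanish, so \<open>Q[z] = Q[e]\<close> is as small as desired, whereas \<open>z \<noteq> 0\<close> because
  \<open>e\<close> is shorter than \<open>x\<close>. Hence the minimum is \<open>0\<close>.

  For the inclusion, the same approximation shows that the points \<open>z / t\<close> are dense in \<open>K\<close>, so a form
  that is nonnegative at the integral points of \<open>K\<close> is nonnegative on \<open>K\<close>. A form of the Ryshkov set
  is thus in the copositive cone, and it is not on its boundary, as its minimum is at least \<open>1\<close>.
\<close>

section \<open>Quadratic forms\<close>

lemma continuous_on_qform [continuous_intros]:
  fixes A :: "'a::topological_space \<Rightarrow> real ^ 'n ^ 'n"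
  assumes "continuous_on S A" "continuous_on S f"
  shows "continuous_on S (\<lambda>a. qform (A a) (f a))"
  unfolding qform_def inner_vec_def matrix_vector_mult_def inner_real_def
  by (simp, intro continuous_intros assms)

lemma qform_scaleR: "qform Q (c *\<^sub>R x) = c\<^sup>2 * qform Q x"
  by (simp add: qform_def matrix_vector_mult_scaleR power2_eq_square)

lemma qform_add:
  assumes "Q \<in> sym_mats"
  shows "qform Q (x + y) = qform Q x + 2 * (y \<bullet> (Q *v x)) + qform Q y"
proof -
  have "x \<bullet> (Q *v y) = y \<bullet> (Q *v x)"
    using assms dot_lmul_matrix[of x Q y] transpose_matrix_vector[of Q x]
    by (simp add: sym_mats_def inner_commute)
  then show ?thesis
    by (simp add: qform_def matrix_vector_right_distrib inner_add_left inner_add_right)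
qed

text \<open>If the inner product were negative, then \<open>Q[s x + y] = 2 s \<langle>y, Q x\<rangle> + Q[y]\<close> would be negative
  for large \<open>s\<close>.\<close>

lemma COP_isotropic_inner_nonneg:
  assumes "convex K" "cone K" "Q \<in> COP K" "x \<in> K" "y \<in> K" "qform Q x = 0"
  shows "0 \<le> y \<bullet> (Q *v x)"
proof (rule ccontr)
  assume neg: "\<not> 0 \<le> y \<bullet> (Q *v x)"
  define a where "a = y \<bullet> (Q *v x)"
  \<comment> \<open>the solution of \<open>2 s a + Q[y] = -1\<close>\<close>
  define s where "s = (qform Q y + 1) / (- 2 * a)"
  have a: "a < 0" using neg by (simp add: a_def)
  have y: "0 \<le> qform Q y" using assms by (simp add: COP_def)
  have s: "0 \<le> s" unfolding s_def using a y by (intro divide_nonneg_nonneg) auto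
  have "1 *\<^sub>R y + s *\<^sub>R x \<in> K"
    using assms s convex_cone_closed_under_combinations[of K] by (meson zero_le_one)
  then have "0 \<le> qform Q (s *\<^sub>R x + y)"
    using assms by (simp add: COP_def add.commute)
  also have "\<dots> = 2 * (s * a) + qform Q y"
    using assms by (simp add: COP_def qform_add qform_scaleR matrix_vector_mult_scaleR a_def)
  also have "\<dots> = -1"
    using a by (simp add: s_def field_simps)
  finally show False by simp
qed

text \<open>The terms \<open>c v \<langle>v, Q x\<rangle>\<close> are nonnegative and sum to \<open>Q[x] = 0\<close>.\<close>

lemma COP_isotropic_orthogonal:
  assumes "convex K" "cone K" "Q \<in> COP K" "qform Q x = 0" "x \<in> K"
    and S: "finite S" "S \<subseteq> K" "\<And>v. v \<in> S \<Longrightarrow> 0 < c v" "x = (\<Sum>v\<in>S. c v *\<^sub>R v)"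
    and e: "e \<in> span S"
  shows "e \<bullet> (Q *v x) = 0"
proof -
  have "0 = x \<bullet> (Q *v x)" using assms by (simp add: qform_def)
  also have "\<dots> = (\<Sum>v\<in>S. c v * (v \<bullet> (Q *v x)))"
    by (subst (1) S(4)) (simp add: inner_sum_left)
  finally have sum: "(\<Sum>v\<in>S. c v * (v \<bullet> (Q *v x))) = 0" by simp
  have nonneg: "0 \<le> c v * (v \<bullet> (Q *v x))" if "v \<in> S" for v
    using that COP_isotropic_inner_nonneg[OF assms(1-3) \<open>x \<in> K\<close> _ assms(4), of v] S
    by (intro mult_nonneg_nonneg) (auto simp: less_imp_le)
  have "c v * (v \<bullet> (Q *v x)) = 0" if "v \<in> S" for v
    using sum_nonneg_0[OF S(1) nonneg sum that] .
  then have "orthogonal (Q *v x) v" if "v \<in> S" for v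
    using S(3)[OF that] that by (fastforce simp: orthogonal_def inner_commute)
  then have "orthogonal (Q *v x) e" by (rule orthogonal_to_span[OF e])
  then show ?thesis by (simp add: orthogonal_def inner_commute)
qed

section \<open>Integral points near an arbitrary ray\<close>

lemma rationally_generated_pos_coeffs:
  assumes "rationally_generated K" "x \<in> K"
  obtains S c where "finite S" "S \<subseteq> K \<inter> int_vecs" "\<And>v. v \<in> S \<Longrightarrow> 0 < c v"
    "x = (\<Sum>v\<in>S. c v *\<^sub>R v)"
proof -
  obtain S c where S: "finite S" "S \<subseteq> K \<inter> int_vecs" "\<forall>v\<in>S. 0 \<le> c v" "x = (\<Sum>v\<in>S. c v *\<^sub>R v)"
    using assms unfolding rationally_generated_def by metis
  show thesis
  proof (rule that[of "{v\<in>S. 0 < c v}" c])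
    show "x = (\<Sum>v\<in>{v\<in>S. 0 < c v}. c v *\<^sub>R v)"
      unfolding S(4) using S(1,3) by (intro sum.mono_neutral_right) (auto simp: less_le)
  qed (use S(1,2) in auto)
qed

lemma convex_cone_nonneg_sum:
  assumes "convex K" "cone K" "K \<noteq> {}" "finite S" "S \<subseteq> K" "\<And>v. v \<in> S \<Longrightarrow> 0 \<le> c v"
  shows "(\<Sum>v\<in>S. c v *\<^sub>R v) \<in> K"
  using assms(4-6)
proof (induction S rule: finite_induct)
  case empty
  then show ?case using assms by (simp add: cone_contains_0)
next
  case (insert v S)
  then have "c v *\<^sub>R v + 1 *\<^sub>R (\<Sum>v\<in>S. c v *\<^sub>R v) \<in> K"
    using assms(1,2) convex_cone_closed_under_combinations[of K]
    by (metis insertI1 insertI2 insert_subset zero_le_one)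
  then show ?case using insert by simp
qed

lemma Dirichlet_approx_finite:
  fixes c :: "'a \<Rightarrow> real"
  assumes "finite S" "0 < \<delta>"
  obtains t :: nat and m :: "'a \<Rightarrow> int"
  where "0 < t" "\<And>v. v \<in> S \<Longrightarrow> \<bar>real t * c v - of_int (m v)\<bar> < \<delta>"
proof -
  obtain f where f: "bij_betw f S {0..<card S}"
    using ex_bij_betw_finite_nat[OF assms(1)] by blast
  obtain N where N: "N > 0" "1 / real N < \<delta>"
    using real_arch_inverse[of \<delta>] assms(2) by (auto simp: inverse_eq_divide)
  obtain q p where q: "0 < q"
    and p: "\<And>i. i < card S \<Longrightarrow> \<bar>of_int q * c (inv_into S f i) - of_int (p i)\<bar> < 1 / real N"
    using Dirichlet_approx_simult[OF N(1), of "card S" "\<lambda>i. c (inv_into S f i)"] by metis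
  show thesis
  proof (rule that[of "nat q" "p \<circ> f"])
    fix v assume v: "v \<in> S"
    then have "f v < card S" "inv_into S f (f v) = v"
      using f by (auto simp: bij_betw_def)
    then show "\<bar>real (nat q) * c v - of_int ((p \<circ> f) v)\<bar> < \<delta>"
      using p[of "f v"] N q by simp
  qed (use q in simp)
qed

text \<open>Replacing \<open>t c v\<close> by a nearby integer \<open>m v\<close> keeps the vector in \<open>K\<close>: an integer that
  is closer than \<open>1\<close> to a positive number is nonnegative. The error is confined to the span of the
  generators of \<open>x\<close>.\<close>

lemma integral_approximation_of_multiple:
  assumes "convex K" "cone K" "x \<in> K"
    and S: "finite S" "S \<subseteq> K \<inter> int_vecs" "\<And>v. v \<in> S \<Longrightarrow> 0 < c v" "x = (\<Sum>v\<in>S. c v *\<^sub>R v)"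
    and "0 < \<delta>"
  obtains t :: nat and z where "0 < t" "z \<in> K \<inter> int_vecs" "z - real t *\<^sub>R x \<in> span S"
    "norm (z - real t *\<^sub>R x) < \<delta>"
proof -
  \<comment> \<open>Coefficient errors below \<open>\<delta> / B\<close> add up to less than \<open>\<delta>\<close>; the summand \<open>1\<close> keeps \<open>B\<close> positive
    when \<open>S\<close> is empty.\<close>
  define B where "B = 1 + (\<Sum>v\<in>S. norm v)"
  have B: "0 < B" unfolding B_def by (simp add: add_pos_nonneg sum_nonneg)
  obtain t m where t: "0 < t"
    and m: "\<And>v. v \<in> S \<Longrightarrow> \<bar>real t * c v - of_int (m v)\<bar> < min 1 (\<delta> / B)"
    using Dirichlet_approx_finite[OF S(1), of "min 1 (\<delta> / B)" c] \<open>0 < \<delta>\<close> B by auto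
  define z where "z = (\<Sum>v\<in>S. of_int (m v) *\<^sub>R v)"
  have m0: "0 \<le> m v" if "v \<in> S" for v
  proof -
    have "0 < real t * c v" using t S(3)[OF that] by simp
    then have "-1 < (of_int (m v) :: real)" using m[OF that] by linarith
    then show ?thesis by linarith
  qed
  have diff: "z - real t *\<^sub>R x = (\<Sum>v\<in>S. (of_int (m v) - real t * c v) *\<^sub>R v)"
    by (simp add: z_def S(4) scaleR_sum_right sum_subtractf algebra_simps)
  have "norm (z - real t *\<^sub>R x) \<le> (\<Sum>v\<in>S. \<delta> / B * norm v)"
    unfolding diff
  proof (rule sum_norm_le)
    fix v assume "v \<in> S"
    then show "norm ((of_int (m v) - real t * c v) *\<^sub>R v) \<le> \<delta> / B * norm v"
      using m[of v] mult_right_mono[of "\<bar>of_int (m v) - real t * c v\<bar>" "\<delta> / B" "norm v"]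
      by (simp add: abs_minus_commute)
  qed
  also have "\<dots> = \<delta> / B * (B - 1)" by (simp add: B_def sum_distrib_left)
  also have "\<dots> < \<delta>" using B \<open>0 < \<delta>\<close> by (simp add: field_simps)
  finally have small: "norm (z - real t *\<^sub>R x) < \<delta>" .
  have "z \<in> K"
    unfolding z_def using assms m0 by (intro convex_cone_nonneg_sum) auto
  moreover have "z \<in> int_vecs"
    using S(2) unfolding z_def int_vecs_def by (auto intro!: Ints_sum Ints_mult)
  moreover have "z - real t *\<^sub>R x \<in> span S"
    unfolding diff by (intro span_sum span_scale span_base)
  ultimately show thesis using that t small by blast
qed

section \<open>The boundary of the generalized copositive cone\<close>

lemma closed_COP:
  fixes K :: "(real ^ 'n) set"
  shows "closed (COP K)"
proof -
  have "COP K = {Q. transpose Q = Q} \<inter> (\<Inter>x\<in>K. {Q. 0 \<le> qform Q x})"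
    by (auto simp: COP_def sym_mats_def)
  moreover have "closed {Q :: real ^ 'n ^ 'n. transpose Q = Q}"
    unfolding transpose_def by (intro closed_Collect_eq continuous_intros)
  moreover have "closed {Q. 0 \<le> qform Q x}" for x :: "real ^ 'n"
    by (intro closed_Collect_le continuous_intros)
  ultimately show ?thesis by (simp add: closed_INT closed_Int)
qed

text \<open>By compactness of the unit sphere of \<open>K\<close>, positivity on \<open>K - {0}\<close> is an open condition on \<open>Q\<close>.\<close>

lemma positive_imp_interior_COP:
  fixes K :: "(real ^ 'n) set"
  assumes "closed K" "cone K" "Q \<in> sym_mats" and pos: "\<And>x. x \<in> K \<Longrightarrow> x \<noteq> 0 \<Longrightarrow> 0 < qform Q x"
  shows "Q \<in> sym_topology interior_of (COP K)"
proof -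
  define S where "S = K \<inter> sphere 0 1"
  define N where "N = {A. \<exists>x. x \<in> S \<and> (x, A) \<in> {p. qform (snd p) (fst p) \<le> 0}}"
  have "compact S" using assms by (simp add: S_def closed_Int_compact)
  moreover have "closed {p :: (real ^ 'n) \<times> (real ^ 'n ^ 'n). qform (snd p) (fst p) \<le> 0}"
    by (intro closed_Collect_le continuous_intros)
  ultimately have "closed N" unfolding N_def by (rule closed_compact_projection)
  then have op: "openin sym_topology (sym_mats \<inter> - N)" by (intro openin_open_Int) auto
  have "0 \<le> qform A x" if "A \<notin> N" "x \<in> K" for A x
  proof (cases "x = 0")
    case False
    then have "x /\<^sub>R norm x \<in> S"
      using that(2) \<open>cone K\<close> by (auto simp: S_def cone_def)
    then have "0 < qform A (x /\<^sub>R norm x)" using that(1) by (force simp: N_def)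
    then show ?thesis by (simp add: qform_scaleR zero_less_mult_iff)
  qed (simp add: qform_def)
  then have "sym_mats \<inter> - N \<subseteq> COP K" by (auto simp: COP_def)
  moreover have "Q \<in> sym_mats \<inter> - N"
    using assms(3) pos by (force simp: N_def S_def not_le)
  ultimately show ?thesis using interior_of_maximal[OF _ op] by blast
qed

lemma frontier_COP: "sym_topology frontier_of (COP K) = COP K - sym_topology interior_of (COP K)"
proof -
  have "COP K \<subseteq> sym_mats" by (auto simp: COP_def)
  then have "closedin sym_topology (COP K)" by (intro closed_subset closed_COP)
  then show ?thesis by (simp add: frontier_of_def closure_of_closedin)
qed

lemma COP_frontier_isotropic:
  assumes "closed K" "cone K" "Q \<in> sym_topology frontier_of (COP K)"
  obtains x where "x \<in> K" "x \<noteq> 0" "qform Q x = 0"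
proof -
  have Q: "Q \<in> COP K" "Q \<notin> sym_topology interior_of (COP K)"
    using assms(3) by (auto simp: frontier_COP)
  then obtain x where "x \<in> K" "x \<noteq> 0" "\<not> 0 < qform Q x"
    using positive_imp_interior_COP[OF assms(1,2), of Q] by (auto simp: COP_def)
  moreover from this Q have "0 \<le> qform Q x" by (simp add: COP_def)
  ultimately show thesis using that by force
qed

section \<open>The Interior Ryshkov property\<close>

text \<open>With \<open>e = z - t x\<close> for the approximating integral vector \<open>z\<close>, both \<open>Q[x]\<close> and \<open>\<langle>e, Q x\<rangle>\<close>
  vanish, so \<open>Q[z] = Q[e]\<close>.\<close>

lemma isotropic_imp_small_integral_value:
  assumes "convex K" "cone K" "rationally_generated K" "Q \<in> COP K"
    and x: "x \<in> K" "x \<noteq> 0" "qform Q x = 0" and "0 < \<epsilon>"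
  obtains z where "z \<in> K \<inter> int_vecs - {0}" "qform Q z < \<epsilon>"
proof -
  obtain S c where S: "finite S" "S \<subseteq> K \<inter> int_vecs" "\<And>v. v \<in> S \<Longrightarrow> 0 < c v"
    "x = (\<Sum>v\<in>S. c v *\<^sub>R v)"
    using rationally_generated_pos_coeffs[OF assms(3) x(1)] by metis
  have "open {e. qform Q e < \<epsilon>}" by (intro open_Collect_less continuous_intros)
  moreover have "0 \<in> {e. qform Q e < \<epsilon>}" using \<open>0 < \<epsilon>\<close> by (simp add: qform_def)
  ultimately obtain \<delta> where \<delta>: "0 < \<delta>" "ball 0 \<delta> \<subseteq> {e. qform Q e < \<epsilon>}"
    using open_contains_ball by blast
  obtain t :: nat and z where t: "0 < t" and z: "z \<in> K \<inter> int_vecs"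
    and e: "z - real t *\<^sub>R x \<in> span S" "norm (z - real t *\<^sub>R x) < min \<delta> (norm x)"
    using integral_approximation_of_multiple[OF assms(1,2) x(1) S, of "min \<delta> (norm x)"] \<delta>(1) x(2)
    by auto
  define d where "d = z - real t *\<^sub>R x"
  have "z \<noteq> 0"
  proof
    assume "z = 0"
    then have "real t * norm x < norm x" using e(2) by simp
    then show False using t x(2) by simp
  qed
  have "d \<bullet> (Q *v x) = 0"
    using COP_isotropic_orthogonal[OF assms(1,2,4) x(3,1) S(1) _ S(3,4), of d] S(2) e(1)
    by (auto simp: d_def)
  moreover have "z = real t *\<^sub>R x + d" by (simp add: d_def)
  ultimately have "qform Q z = qform Q d"
    using assms(4) x(3) by (simp add: COP_def qform_add qform_scaleR matrix_vector_mult_scaleR)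
  also have "\<dots> < \<epsilon>" using \<delta>(2) e(2) by (auto simp: d_def)
  finally show thesis using that z \<open>z \<noteq> 0\<close> by blast
qed

text \<open>If \<open>Q[x] < 0\<close>, then \<open>Q\<close> is negative near \<open>x\<close>, hence at some \<open>z / t\<close> with \<open>z\<close> an integral
  vector in \<open>K\<close>.\<close>

lemma ryshkov_subset_COP:
  assumes "convex K" "cone K" "rationally_generated K"
  shows "ryshkov K \<subseteq> COP K"
proof
  fix Q assume Q: "Q \<in> ryshkov K"
  have "0 \<le> qform Q x" if x: "x \<in> K" for x
  proof (rule ccontr)
    assume "\<not> 0 \<le> qform Q x"
    moreover have "open {y. qform Q y < 0}" by (intro open_Collect_less continuous_intros)
    ultimately obtain \<delta> where \<delta>: "0 < \<delta>" "ball x \<delta> \<subseteq> {y. qform Q y < 0}"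
      by (metis mem_Collect_eq not_le open_contains_ball)
    obtain S c where S: "finite S" "S \<subseteq> K \<inter> int_vecs" "\<And>v. v \<in> S \<Longrightarrow> 0 < c v"
      "x = (\<Sum>v\<in>S. c v *\<^sub>R v)"
      using rationally_generated_pos_coeffs[OF assms(3) x] by metis
    obtain t :: nat and z where t: "0 < t" and z: "z \<in> K \<inter> int_vecs"
      and e: "norm (z - real t *\<^sub>R x) < \<delta>"
      using integral_approximation_of_multiple[OF assms(1,2) x S \<delta>(1)] .
    have "norm (z /\<^sub>R real t - x) = norm (z - real t *\<^sub>R x) / real t"
      using t norm_scaleR[of "inverse (real t)" "z - real t *\<^sub>R x"]
      by (simp add: scaleR_diff_right divide_inverse)
    also have "\<dots> \<le> norm (z - real t *\<^sub>R x)"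
      using t by (simp add: divide_le_eq mult_left_le_one_le mult_le_cancel_left1)
    finally have "z /\<^sub>R real t \<in> ball x \<delta>"
      using e by (simp add: dist_norm norm_minus_commute)
    then have neg: "qform Q z < 0"
      using \<delta>(2) t by (force simp: qform_scaleR mult_less_0_iff)
    then have "z \<noteq> 0" by (auto simp: qform_def)
    then have "1 \<le> qform Q z" using Q z by (auto simp: ryshkov_def)
    then show False using neg by simp
  qed
  then show "Q \<in> COP K" using Q by (auto simp: ryshkov_def COP_def)
qed

theorem theorem4p1:
  fixes K :: "(real ^ 'n) set"
  assumes "closed K" and "convex K" and "cone K"
    and "rationally_generated K"
  shows "interior_ryshkov K \<and> ryshkov K \<subseteq> sym_topology interior_of (COP K)"
proof -
  have frontier: "cop_min K Q = 0" if Q: "Q \<in> sym_topology frontier_of (COP K)" for Q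
  proof -
    have QC: "Q \<in> COP K" using Q by (simp add: frontier_COP)
    obtain x where x: "x \<in> K" "x \<noteq> 0" "qform Q x = 0"
      using COP_frontier_isotropic[OF assms(1,3) Q] .
    have "cop_min K Q \<le> 0 + ereal \<epsilon>" if "0 < \<epsilon>" for \<epsilon>
    proof -
      obtain z where z: "z \<in> K \<inter> int_vecs - {0}" "qform Q z < \<epsilon>"
        using isotropic_imp_small_integral_value[OF assms(2-4) QC x \<open>0 < \<epsilon>\<close>] .
      have "cop_min K Q \<le> ereal (qform Q z)" unfolding cop_min_def by (rule INF_lower[OF z(1)])
      also have "\<dots> \<le> 0 + ereal \<epsilon>" using z(2) by simp
      finally show ?thesis .
    qed
    then have "cop_min K Q \<le> 0" by (rule ereal_le_epsilon2)
    moreover have "0 \<le> cop_min K Q"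
      unfolding cop_min_def using QC by (intro INF_greatest) (auto simp: COP_def)
    ultimately show ?thesis by (rule antisym)
  qed
  have "Q \<in> sym_topology interior_of (COP K)" if Q: "Q \<in> ryshkov K" for Q
  proof (rule ccontr)
    assume "Q \<notin> sym_topology interior_of (COP K)"
    then have "cop_min K Q = 0"
      using frontier Q ryshkov_subset_COP[OF assms(2-4)] by (auto simp: frontier_COP)
    moreover have "1 \<le> cop_min K Q"
      unfolding cop_min_def using Q by (intro INF_greatest) (auto simp: ryshkov_def)
    ultimately show False by simp
  qed
  then show ?thesis using frontier by (auto simp: interior_ryshkov_def)
qed

end
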